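(* Let $\mu\in\mathbb{R}$, $b>0$, let $X_{\mu,b}$ be a Laplace random variable with parameters $\mu$ and $b$, and let $Z$ be a standard normal random variable. Then $$P\left\{|X_{\mu,b}-E[X_{\mu,b}]|\le \sqrt{\mathrm{Var}(X_{\mu,b})}\right\}\approx 0.7568833>P\{|Z|\le 1\}\approx 0.6827.$$
   Context: A Laplace random variable with parameters $\mu\in\mathbb{R}$ and $b>0$ has cumulative distribution function $P\{X_{\mu,b}\le x\}=\frac12\exp\left(\frac{x-\mu}{b}\right)$ for $x\le\mu$ and $P\{X_{\mu,b}\le x\}=1-\frac12\exp\left(-\frac{x-\mu}{b}\right)$ for $x>\mu$. The symbol $\approx$ means equality after rounding to the number of decimals displayed. *)

theory Defs
  imports "HOL-Probability.Probability"
begin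

definition laplace_cdf :: "real \<Rightarrow> real \<Rightarrow> real \<Rightarrow> real" where
  "laplace_cdf \<mu> b x =
     (if x \<le> \<mu> then 1 / 2 * exp ((x - \<mu>) / b) else 1 - 1 / 2 * exp (- ((x - \<mu>) / b)))"

definition laplace_random_variable ::
    "'a measure \<Rightarrow> real \<Rightarrow> real \<Rightarrow> ('a \<Rightarrow> real) \<Rightarrow> bool" where
  "laplace_random_variable M \<mu> b X \<longleftrightarrow>
     X \<in> borel_measurable M \<and> (\<forall>x. \<P>(\<omega> in M. X \<omega> \<le> x) = laplace_cdf \<mu> b x)"

(* Ties are rounded upwards, as round does. *)
definition round_decimals :: "nat \<Rightarrow> real \<Rightarrow> real" where
  "round_decimals d x = of_int (round (10 ^ d * x)) / 10 ^ d"

end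

(* X has density exp (- |x - mu| / b) / (2 b), so E X = mu and Var X = 2 b^2, and the first
   probability is 1 - exp (- sqrt 2). The normal probability is the integral of exp (- x^2 / 2)
   over [-1,1] divided by sqrt (2 pi). The numerical claims follow from Taylor polynomials of exp,
   and of arctan in Machin's formula for pi. *)

theory Submission
  imports Defs "HOL-Real_Asymp.Real_Asymp"
begin

section \<open>The Laplace density and its distribution function\<close>

definition laplace_density :: "real \<Rightarrow> real \<Rightarrow> real \<Rightarrow> real" where
  "laplace_density \<mu> b x = exp (- (\<bar>x - \<mu>\<bar> / b)) / (2 * b)"

lemma laplace_density_nonneg: "b > 0 \<Longrightarrow> 0 \<le> laplace_density \<mu> b x"
  by (simp add: laplace_density_def)

lemma borel_measurable_laplace_density [measurable]: "laplace_density \<mu> b \<in> borel_measurable borel"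
  unfolding laplace_density_def by measurable

text \<open>All of \<open>{..a}\<close> lies left of \<mu>, so the absolute value has a fixed sign
  there. The reflection of x to -x turns the lower tail into an upper one, to which the fundamental
  theorem on \<open>{-a..}\<close> applies; the antiderivative vanishes at infinity.\<close>

lemma nn_integral_laplace_density_lower:
  assumes b: "b > 0" and a: "a \<le> \<mu>"
  shows "(\<integral>\<^sup>+x. ennreal (laplace_density \<mu> b x) * indicator {..a} x \<partial>lborel) = ennreal (laplace_cdf \<mu> b a)"
proof -
  let ?F = "\<lambda>x. - exp (- ((x + \<mu>) / b)) / 2"
  have "(\<integral>\<^sup>+x. ennreal (laplace_density \<mu> b x) * indicator {..a} x \<partial>lborel)
      = (\<integral>\<^sup>+x. ennreal (laplace_density \<mu> b (- x)) * indicator {..a} (- x) \<partial>lborel)"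
    by (subst nn_integral_real_affine[where c="-1" and t=0]) simp_all
  also have "\<dots> = (\<integral>\<^sup>+x. ennreal (exp (- ((x + \<mu>) / b)) / (2 * b)) * indicator {-a..} x \<partial>lborel)"
    using a by (intro nn_integral_cong) (auto simp: laplace_density_def indicator_def algebra_simps)
  also have "\<dots> = ennreal (0 - ?F (- a))"
  proof (rule nn_integral_FTC_atLeast)
    show "((\<lambda>x. - exp (- ((x + \<mu>) / b)) / 2) \<longlongrightarrow> 0) at_top"
      using b by real_asymp
  qed (use b in \<open>auto intro!: derivative_eq_intros\<close>)
  also have "0 - ?F (- a) = laplace_cdf \<mu> b a"
  proof -
    have "- ((- a + \<mu>) / b) = (a - \<mu>) / b" by argo
    with a show ?thesis by (simp add: laplace_cdf_def)
  qed
  finally show ?thesis .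
qed

text \<open>Beyond \<mu> the half-line is split at \<mu>: the left part has mass 1/2 by the previous
  lemma, and the fundamental theorem on \<open>{\<mu>..a}\<close> gives the rest.\<close>

lemma nn_integral_laplace_density_atMost:
  assumes b: "b > 0"
  shows "(\<integral>\<^sup>+x. ennreal (laplace_density \<mu> b x) * indicator {..a} x \<partial>lborel) = ennreal (laplace_cdf \<mu> b a)"
proof (cases "a \<le> \<mu>")
  case False
  let ?f = "\<lambda>x. exp (- ((x - \<mu>) / b)) / (2 * b)"
  let ?F = "\<lambda>x. - exp (- ((x - \<mu>) / b)) / 2"
  have "(\<integral>\<^sup>+x. ennreal (laplace_density \<mu> b x) * indicator {..a} x \<partial>lborel)
      = (\<integral>\<^sup>+x. (ennreal (laplace_density \<mu> b x) * indicator {..\<mu>} x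
            + ennreal (?f x) * indicator {\<mu>..a} x) \<partial>lborel)"
    \<comment> \<open>The two pieces both contain \<mu>, so the integrands agree only away from this
      null point.\<close>
    using AE_lborel_singleton[of \<mu>] False
    by (intro nn_integral_cong_AE)
       (auto elim!: eventually_mono simp: indicator_def laplace_density_def)
  also have "\<dots> = (\<integral>\<^sup>+x. ennreal (laplace_density \<mu> b x) * indicator {..\<mu>} x \<partial>lborel)
            + (\<integral>\<^sup>+x. ennreal (?f x) * indicator {\<mu>..a} x \<partial>lborel)"
    by (rule nn_integral_add) auto
  also have "(\<integral>\<^sup>+x. ennreal (?f x) * indicator {\<mu>..a} x \<partial>lborel) = ennreal (?F a - ?F \<mu>)"
    by (rule nn_integral_FTC_Icc) (use False b in \<open>auto intro!: derivative_eq_intros\<close>)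
  also have "(\<integral>\<^sup>+x. ennreal (laplace_density \<mu> b x) * indicator {..\<mu>} x \<partial>lborel) = ennreal (1 / 2)"
    using nn_integral_laplace_density_lower[OF b order_refl, of \<mu>] by (simp add: laplace_cdf_def)
  also have "ennreal (1 / 2) + ennreal (?F a - ?F \<mu>) = ennreal (1 / 2 + (?F a - ?F \<mu>))"
    by (rule ennreal_plus[symmetric]) (use False b in auto)
  also have "1 / 2 + (?F a - ?F \<mu>) = laplace_cdf \<mu> b a"
    using False by (simp add: laplace_cdf_def)
  finally show ?thesis .
qed (simp add: nn_integral_laplace_density_lower[OF b])

text \<open>Half-lines generate the Borel sets, so agreement of the distribution function with the
  integrals of the density over all \<open>{..a}\<close> identifies the law of
  \<open>X\<close>.\<close>

lemma (in prob_space) distributed_laplace_density: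
  assumes b: "b > 0" and X: "laplace_random_variable M \<mu> b X"
  shows "distributed M lborel X (laplace_density \<mu> b)"
proof (rule distributedI_borel_atMost)
  show "emeasure M {x \<in> space M. X x \<le> a} = ennreal (laplace_cdf \<mu> b a)" for a
    using X by (simp add: laplace_random_variable_def emeasure_eq_measure)
  show "(\<integral>\<^sup>+x. ennreal (laplace_density \<mu> b x * indicator {..a} x) \<partial>lborel)
      = ennreal (laplace_cdf \<mu> b a)" for a
    using nn_integral_laplace_density_atMost[OF b] by (simp add: nn_integral_set_ennreal)
qed (use X laplace_density_nonneg[OF b] in \<open>simp_all add: laplace_random_variable_def\<close>)

section \<open>Central moments of the Laplace density\<close>

lemma has_bochner_integral_power_times_exp_Ici:
  "has_bochner_integral lborel (\<lambda>x::real. indicator {0..} x *\<^sub>R (x ^ k * exp (- \<bar>x\<bar>))) (fact k)"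
proof (rule has_bochner_integral_nn_integral)
  \<comment> \<open>On \<open>{0..}\<close> the absolute value disappears and the Gamma integral k!
    remains. The indicator and \<open>\<bar>x\<bar>\<close> are in the statement because the rules
    for even and odd functions extend such an integrand to the whole line.\<close>
  have "(\<integral>\<^sup>+x. ennreal (indicator {0..} x *\<^sub>R (x ^ k * exp (- \<bar>x\<bar>))) \<partial>lborel)
      = (\<integral>\<^sup>+x. ennreal (x ^ k * exp (- x)) * indicator {0..} x \<partial>lborel)"
    by (intro nn_integral_cong) (auto simp: indicator_def)
  then show "(\<integral>\<^sup>+x. ennreal (indicator {0..} x *\<^sub>R (x ^ k * exp (- \<bar>x\<bar>))) \<partial>lborel) = ennreal (fact k)"
    by (simp add: nn_intergal_power_times_exp_Ici)
qed (auto simp: indicator_def)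

text \<open>The substitution of \<mu> + b x for x reduces to location 0 and scale 1. The Jacobian b
  cancels the b in the normalization 1 / (2 b), which leaves the factor 1/2.\<close>

lemma has_bochner_integral_laplace_moment_scale:
  assumes b: "b > 0"
    and I: "has_bochner_integral lborel (\<lambda>x. x ^ k * exp (- \<bar>x\<bar>)) I"
  shows "has_bochner_integral lborel (\<lambda>x. laplace_density \<mu> b x * (x - \<mu>) ^ k) (b ^ k * I / 2)"
proof (subst lborel_has_bochner_integral_real_affine_iff[where c=b and t=\<mu>])
  have eq: "laplace_density \<mu> b (\<mu> + b * x) * (\<mu> + b * x - \<mu>) ^ k
      = (b ^ k / (2 * b)) * (x ^ k * exp (- \<bar>x\<bar>))" for x
    using b by (simp add: laplace_density_def abs_mult power_mult_distrib)
  show "has_bochner_integral lborel (\<lambda>x. laplace_density \<mu> b (\<mu> + b * x) * (\<mu> + b * x - \<mu>) ^ k)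
      (b ^ k * I / 2 /\<^sub>R \<bar>b\<bar>)"
    using has_bochner_integral_mult_right[OF I, of "b ^ k / (2 * b)"] b
    unfolding eq by (simp add: field_simps)
qed (use b in simp)

text \<open>Each half-line contributes k! to the standardized integral, and the sum 2 k! absorbs the
  factor 1/2.\<close>

lemma has_bochner_integral_laplace_moment_even:
  assumes "b > 0" "even k"
  shows "has_bochner_integral lborel (\<lambda>x. laplace_density \<mu> b x * (x - \<mu>) ^ k) (b ^ k * fact k)"
proof -
  have "has_bochner_integral lborel (\<lambda>x::real. x ^ k * exp (- \<bar>x\<bar>)) (2 * fact k)"
    using has_bochner_integral_even_function[OF has_bochner_integral_power_times_exp_Ici[of k]] assms(2)
    by simp
  from has_bochner_integral_laplace_moment_scale[OF assms(1) this] show ?thesis by simp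
qed

text \<open>The contributions of the two half-lines cancel. Integrability is part of the claim and
  is what the computation of the mean starts from.\<close>

lemma has_bochner_integral_laplace_moment_odd:
  assumes "b > 0" "odd k"
  shows "has_bochner_integral lborel (\<lambda>x. laplace_density \<mu> b x * (x - \<mu>) ^ k) 0"
proof -
  have "has_bochner_integral lborel (\<lambda>x::real. x ^ k * exp (- \<bar>x\<bar>)) 0"
    using has_bochner_integral_odd_function[OF has_bochner_integral_power_times_exp_Ici[of k]] assms(2)
    by simp
  from has_bochner_integral_laplace_moment_scale[OF assms(1) this] show ?thesis by simp
qed

section \<open>Mean, variance and concentration of a Laplace variable\<close>

context prob_space
begin

lemma laplace_expectation:
  assumes b: "b > 0" and X: "laplace_random_variable M \<mu> b X"
  shows "expectation X = \<mu>"
proof -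
  note D = distributed_laplace_density[OF assms]
  have "has_bochner_integral lborel (\<lambda>x. laplace_density \<mu> b x * (x - \<mu>)) 0"
    using has_bochner_integral_laplace_moment_odd[OF b, of 1 \<mu>] by simp
  then have "integrable M (\<lambda>\<omega>. X \<omega> - \<mu>)" "expectation (\<lambda>\<omega>. X \<omega> - \<mu>) = 0"
    using distributed_integrable[OF D, of "\<lambda>x. x - \<mu>"] distributed_integral[OF D, of "\<lambda>x. x - \<mu>"]
      laplace_density_nonneg[OF b]
    by (auto simp: has_bochner_integral_iff)
  \<comment> \<open>Linearity of the expectation needs \<open>X\<close> itself to be integrable;
    this follows from the centred variable by adding the constant \<mu>.\<close>
  moreover from this(1) have "integrable M X"
    using Bochner_Integration.integrable_add[of M "\<lambda>\<omega>. X \<omega> - \<mu>" "\<lambda>_. \<mu>"] by simp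
  ultimately show ?thesis by (simp add: prob_space)
qed

lemma laplace_variance:
  assumes b: "b > 0" and X: "laplace_random_variable M \<mu> b X"
  shows "variance X = 2 * b\<^sup>2"
proof -
  note D = distributed_laplace_density[OF assms]
  have "(\<integral>x. laplace_density \<mu> b x * (x - \<mu>)\<^sup>2 \<partial>lborel) = 2 * b\<^sup>2"
    using has_bochner_integral_laplace_moment_even[OF b, of 2 \<mu>]
    by (simp add: has_bochner_integral_iff)
  then show ?thesis
    using distributed_integral[OF D, of "\<lambda>x. (x - \<mu>)\<^sup>2"] laplace_density_nonneg[OF b]
    by (simp add: laplace_expectation[OF assms])
qed

text \<open>The event is the difference of \<open>X \<omega> \<le> \<mu> + s\<close> and
  \<open>X \<omega> < \<mu> - s\<close>. The distribution function speaks of non-strict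
  inequalities, so the lower endpoint must be shown to carry no mass, which holds because
  \<open>X\<close> has a density.\<close>

lemma laplace_prob_abs_le:
  assumes b: "b > 0" and X: "laplace_random_variable M \<mu> b X" and s: "s \<ge> 0"
  shows "\<P>(\<omega> in M. \<bar>X \<omega> - \<mu>\<bar> \<le> s) = 1 - exp (- (s / b))"
proof -
  note D = distributed_laplace_density[OF b X]
  have [measurable]: "X \<in> borel_measurable M"
    using X by (simp add: laplace_random_variable_def)
  have "emeasure M (X -` {\<mu> - s} \<inter> space M)
      = (\<integral>\<^sup>+x. ennreal (laplace_density \<mu> b x) * indicator {\<mu> - s} x \<partial>lborel)"
    by (rule distributed_emeasure[OF D]) simp
  also have "\<dots> = 0"
    using AE_lborel_singleton[of "\<mu> - s"]
    by (subst nn_integral_0_iff_AE) (auto elim!: eventually_mono simp: indicator_def)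
  finally have null: "prob {\<omega> \<in> space M. X \<omega> = \<mu> - s} = 0"
    by (simp add: measure_def vimage_def Int_def conj_commute)
  have "prob {\<omega> \<in> space M. X \<omega> \<le> \<mu> + s}
      = prob ({\<omega> \<in> space M. \<bar>X \<omega> - \<mu>\<bar> \<le> s} \<union> {\<omega> \<in> space M. X \<omega> < \<mu> - s})"
    using s by (intro arg_cong[where f=prob]) (auto simp: abs_le_iff)
  also have "\<dots> = prob {\<omega> \<in> space M. \<bar>X \<omega> - \<mu>\<bar> \<le> s} + prob {\<omega> \<in> space M. X \<omega> < \<mu> - s}"
    by (rule finite_measure_Union) auto
  finally have 1: "prob {\<omega> \<in> space M. \<bar>X \<omega> - \<mu>\<bar> \<le> s}
      = laplace_cdf \<mu> b (\<mu> + s) - prob {\<omega> \<in> space M. X \<omega> < \<mu> - s}"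
    using X by (simp add: laplace_random_variable_def)
  have "prob {\<omega> \<in> space M. X \<omega> \<le> \<mu> - s}
      = prob ({\<omega> \<in> space M. X \<omega> < \<mu> - s} \<union> {\<omega> \<in> space M. X \<omega> = \<mu> - s})"
    by (intro arg_cong[where f=prob]) auto
  also have "\<dots> = prob {\<omega> \<in> space M. X \<omega> < \<mu> - s}"
    by (subst finite_measure_Union) (auto simp: null)
  finally have "prob {\<omega> \<in> space M. X \<omega> < \<mu> - s} = laplace_cdf \<mu> b (\<mu> - s)"
    using X by (simp add: laplace_random_variable_def)
  with 1 s b show ?thesis
    by (auto simp: laplace_cdf_def)
qed

text \<open>The standard deviation is sqrt 2 times b, so its ratio to b, and with it the
  probability, is free of both parameters.\<close>

lemma laplace_prob_one_sd:
  assumes b: "b > 0" and X: "laplace_random_variable M \<mu> b X"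
  shows "\<P>(\<omega> in M. \<bar>X \<omega> - expectation X\<bar> \<le> sqrt (variance X)) = 1 - exp (- sqrt 2)"
proof -
  have "sqrt (2 * b\<^sup>2) = sqrt 2 * b"
    using b by (simp add: real_sqrt_mult)
  then show ?thesis
    using laplace_prob_abs_le[OF assms, of "sqrt 2 * b"] b
    \<comment> \<open>The variance is unfolded first: its expression contains
      \<open>expectation X\<close>, and rewriting that beforehand would destroy the pattern.\<close>
    unfolding laplace_variance[OF assms] unfolding laplace_expectation[OF assms] by simp
qed

end

section \<open>Numerical bounds for exp (- sqrt 2) and pi\<close>

lemma exp_minus_Taylor_bound:
  fixes x :: real
  assumes "0 \<le> x"
  shows "\<bar>exp (- x) - (\<Sum>m<n. (- x) ^ m / fact m)\<bar> \<le> exp x * x ^ n / fact n"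
proof -
  obtain t where t: "\<bar>t\<bar> \<le> \<bar>- x\<bar>"
      "exp (- x) = (\<Sum>m<n. (- x) ^ m / fact m) + exp t / fact n * (- x) ^ n"
    using Maclaurin_exp_le[of "- x" n] by blast
  have "\<bar>exp (- x) - (\<Sum>m<n. (- x) ^ m / fact m)\<bar> = exp t * x ^ n / fact n"
    unfolding t(2) using assms by (simp add: abs_mult power_abs)
  \<comment> \<open>The intermediate point \<open>t\<close> of the Lagrange remainder satisfies
    \<open>\<bar>t\<bar> \<le> x\<close>, hence \<open>exp t \<le> exp x\<close>.\<close>
  also have "\<dots> \<le> exp x * x ^ n / fact n"
    using t(1) assms by (intro divide_right_mono mult_right_mono) auto
  finally show ?thesis .
qed

text \<open>The endpoints lie half a unit of the seventh decimal on either side of 0.2431167 = 1 -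
  0.7568833. Since even powers of sqrt 2 are rational, the Taylor polynomial is of the form A - B
  sqrt 2 with rational A and B, and rational bounds for sqrt 2 decide the claim.\<close>

lemma exp_minus_sqrt_2_bounds:
  "24311665 / 10 ^ 8 < exp (- sqrt 2)" "exp (- sqrt 2) < 24311675 / 10 ^ 8"
proof -
  let ?s = "sqrt 2"
  have s: "14142135623 / 10 ^ 10 < ?s" "?s < 14142135624 / 10 ^ 10"
    by (rule real_less_rsqrt real_less_lsqrt; simp add: power2_eq_square)+
  have "exp ?s \<le> exp 2" using s by simp
  also have "exp (2::real) = exp 1 ^ 2" by (simp add: exp_of_nat_mult[symmetric])
  also have "\<dots> \<le> 9" using exp_le power_mono[of "exp (1::real)" 3 2] by simp
  finally have e: "exp ?s \<le> 9" .
  have p2: "?s ^ (2 * k) = 2 ^ k" for k by (simp add: power_mult)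
  have p: "?s ^ 2 = 2" "?s ^ 3 = 2 * ?s" "?s ^ 4 = 4" "?s ^ 5 = 4 * ?s" "?s ^ 6 = 8"
    "?s ^ 7 = 8 * ?s" "?s ^ 8 = 16" "?s ^ 9 = 16 * ?s" "?s ^ 10 = 32" "?s ^ 11 = 32 * ?s"
    "?s ^ 12 = 64" "?s ^ 13 = 64 * ?s" "?s ^ 14 = 128" "?s ^ 15 = 128 * ?s" "?s ^ 16 = 256"
    using p2[of 1] p2[of 2] p2[of 3] p2[of 4] p2[of 5] p2[of 6] p2[of 7] p2[of 8]
      power_Suc[of ?s 2] power_Suc[of ?s 4] power_Suc[of ?s 6] power_Suc[of ?s 8]
      power_Suc[of ?s 10] power_Suc[of ?s 12] power_Suc[of ?s 14]
    by simp_all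
  have "exp ?s * ?s ^ 16 / fact 16 \<le> 9 * ?s ^ 16 / fact 16"
    using e by (intro divide_right_mono mult_right_mono) auto
  with exp_minus_Taylor_bound[of ?s 16]
  have B: "\<bar>exp (- ?s) - (\<Sum>m<16. (- ?s) ^ m / fact m)\<bar> \<le> 9 * 256 / fact 16"
    by (simp add: p)
  \<comment> \<open>The remainder bound 2304 / 16! is about 1.1 / 10^10.\<close>
  then have B: "\<bar>exp (- ?s) - (\<Sum>m<16. (- ?s) ^ m / fact m)\<bar> \<le> 1 / 10 ^ 9"
    by (rule order_trans) (simp add: fact_numeral)
  have S: "(\<Sum>m<16. (- ?s) ^ m / fact m) =
      (1 + 2/2 + 4/24 + 8/720 + 16/40320 + 32/3628800 + 64/479001600 + 128/87178291200)
    - (1 + 2/6 + 4/120 + 8/5040 + 16/362880 + 32/39916800 + 64/6227020800 + 128/1307674368000) * ?s"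
    by (simp add: lessThan_nat_numeral p fact_numeral algebra_simps)
  show "24311665 / 10 ^ 8 < exp (- sqrt 2)" "exp (- sqrt 2) < 24311675 / 10 ^ 8"
    using B s unfolding S abs_le_iff by (simp_all add: field_simps)
qed

text \<open>Both differences vanish at 0, and by the finite geometric series their derivatives are
  y^8 / (1 + y^2) and y^6 / (1 + y^2), so they are nondecreasing.\<close>

lemma arctan_Taylor_bounds:
  assumes "0 \<le> (x::real)"
  shows "x - x ^ 3 / 3 + x ^ 5 / 5 - x ^ 7 / 7 \<le> arctan x" "arctan x \<le> x - x ^ 3 / 3 + x ^ 5 / 5"
proof -
  have nz: "1 + y\<^sup>2 > 0" for y :: real by (simp add: add_pos_nonneg)
  let ?f = "\<lambda>y::real. arctan y - (y - y ^ 3 / 3 + y ^ 5 / 5 - y ^ 7 / 7)"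
  let ?g = "\<lambda>y::real. y - y ^ 3 / 3 + y ^ 5 / 5 - arctan y"
  have "?f 0 \<le> ?f x"
  proof (rule DERIV_nonneg_imp_nondecreasing[OF assms])
    fix y :: real assume "0 \<le> y" "y \<le> x"
    have "(?f has_real_derivative y ^ 8 / (1 + y\<^sup>2)) (at y)"
      using nz[of y] by (auto intro!: derivative_eq_intros simp: field_simps)
    then show "\<exists>d. (?f has_real_derivative d) (at y) \<and> 0 \<le> d"
      using nz[of y] by (intro exI conjI) auto
  qed
  then show "x - x ^ 3 / 3 + x ^ 5 / 5 - x ^ 7 / 7 \<le> arctan x" by simp
  have "?g 0 \<le> ?g x"
  proof (rule DERIV_nonneg_imp_nondecreasing[OF assms])
    fix y :: real assume "0 \<le> y" "y \<le> x"
    have "(?g has_real_derivative y ^ 6 / (1 + y\<^sup>2)) (at y)"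
      using nz[of y] by (auto intro!: derivative_eq_intros simp: field_simps)
    then show "\<exists>d. (?g has_real_derivative d) (at y) \<and> 0 \<le> d"
      using nz[of y] by (intro exI conjI) auto
  qed
  then show "arctan x \<le> x - x ^ 3 / 3 + x ^ 5 / 5" by simp
qed

text \<open>Machin's formula is pi / 4 = 4 arctan (1/5) - arctan (1/239). Because of the minus sign,
  each bound for pi pairs one kind of bound at 1/5 with the opposite kind at 1/239.\<close>

lemma pi_bounds: "31415 / 10 ^ 4 < pi" "pi < 31417 / 10 ^ 4"
  using machin arctan_Taylor_bounds[of "1/5"] arctan_Taylor_bounds[of "1/239"]
  by (simp_all add: power_numeral_reduce)

section \<open>The standard normal probability of [-1,1]\<close>

lemma has_integral_exp_Taylor_poly:
  "((\<lambda>x::real. \<Sum>m<8. (- (x\<^sup>2 / 2)) ^ m / fact m) has_integral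
     (\<Sum>m<8. (- 1 / 2) ^ m / fact m * (2 / (2 * real m + 1)))) {-1..1}"
proof (rule has_integral_sum)
  fix m :: nat
  have "((\<lambda>x::real. (- (x\<^sup>2 / 2)) ^ m / fact m) has_integral
      ((- 1 / 2) ^ m / fact m * (1 ^ (2 * m + 1) / (2 * real m + 1))
       - (- 1 / 2) ^ m / fact m * ((- 1) ^ (2 * m + 1) / (2 * real m + 1)))) {-1..1}"
  proof (rule fundamental_theorem_of_calculus)
    fix x :: real
    have d: "((\<lambda>x. x ^ (2 * m + 1) / (2 * real m + 1)) has_real_derivative x ^ (2 * m)) (at x within {-1..1})"
    proof -
      have "2 * real m + 1 \<noteq> 0" by linarith
      then show ?thesis
        by (auto intro!: derivative_eq_intros simp del: power_Suc simp: add.commute)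
    qed
    have eq: "(- (x\<^sup>2 / 2)) ^ m / fact m = (- 1 / 2) ^ m / fact m * x ^ (2 * m)"
      by (simp add: power_mult flip: power_mult_distrib)
    show "((\<lambda>x. (- 1 / 2) ^ m / fact m * (x ^ (2 * m + 1) / (2 * real m + 1))) has_vector_derivative
        (- (x\<^sup>2 / 2)) ^ m / fact m) (at x within {-1..1})"
      unfolding has_real_derivative_iff_has_vector_derivative[symmetric] eq
      by (rule DERIV_cmult[OF d])
  qed simp
  then show "((\<lambda>x::real. (- (x\<^sup>2 / 2)) ^ m / fact m) has_integral
      (- 1 / 2) ^ m / fact m * (2 / (2 * real m + 1))) {-1..1}"
    by (simp add: algebra_simps add_divide_distrib)
qed simp

text \<open>The tolerance splits into three parts of 1 / (3 * 10^6): a pointwise Taylor error of one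
  part over an interval of length 2 uses two of them, and replacing the exact rational value
  \<open>?P\<close> by its decimal approximation uses the third.\<close>

lemma integral_exp_neg_half_square_approx:
  "\<bar>integral {-1..1} (\<lambda>x::real. exp (- x\<^sup>2 / 2)) - 171124878 / 10 ^ 8\<bar> \<le> 1 / 10 ^ 6"
proof -
  let ?p = "\<lambda>x::real. \<Sum>m<8. (- (x\<^sup>2 / 2)) ^ m / fact m"
  let ?P = "\<Sum>m<8. (- 1 / 2) ^ m / fact m * (2 / (2 * real m + 1))"
  have bound: "norm (exp (- x\<^sup>2 / 2) - ?p x) \<le> 1 / (3 * 10 ^ 6)" if "x \<in> cbox (-1) 1" for x :: real
  proof -
    have x: "x\<^sup>2 / 2 \<le> 1 / 2" using that by (simp add: abs_square_le_1 abs_le_iff)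
    have "norm (exp (- x\<^sup>2 / 2) - ?p x) \<le> exp (x\<^sup>2 / 2) * (x\<^sup>2 / 2) ^ 8 / fact 8"
      using exp_minus_Taylor_bound[of "x\<^sup>2 / 2" 8] by simp
    \<comment> \<open>On [-1,1] the argument x^2 / 2 is at most 1/2, and exp 1 is at most 3.\<close>
    also have "\<dots> \<le> 3 * (1 / 2) ^ 8 / fact 8"
    proof (intro divide_right_mono mult_mono power_mono)
      have "exp (x\<^sup>2 / 2) \<le> exp 1" using x by simp
      then show "exp (x\<^sup>2 / 2) \<le> 3" using exp_le by linarith
    qed (use x in auto)
    also have "\<dots> \<le> 1 / (3 * 10 ^ 6 :: real)" by (simp add: fact_numeral power_divide)
    finally show ?thesis .
  qed
  have E: "((\<lambda>x::real. exp (- x\<^sup>2 / 2)) has_integral integral {-1..1} (\<lambda>x::real. exp (- x\<^sup>2 / 2))) {-1..1}"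
    by (intro integrable_integral integrable_continuous_real continuous_intros) simp
  have "((\<lambda>x. exp (- x\<^sup>2 / 2) - ?p x) has_integral
      integral {-1..1} (\<lambda>x::real. exp (- x\<^sup>2 / 2)) - ?P) (cbox (-1) 1)"
    unfolding cbox_interval by (intro has_integral_diff E has_integral_exp_Taylor_poly)
  from has_integral_bound[OF _ this, of "1 / (3 * 10 ^ 6)"] bound
  have "\<bar>integral {-1..1} (\<lambda>x::real. exp (- x\<^sup>2 / 2)) - ?P\<bar> \<le> 2 / (3 * 10 ^ 6)"
    by simp
  moreover have "\<bar>?P - 171124878 / 10 ^ 8\<bar> \<le> 1 / (3 * 10 ^ 6)"
    by (simp add: lessThan_nat_numeral fact_numeral power_divide)
  ultimately show ?thesis unfolding abs_le_iff by linarith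
qed

text \<open>The Lebesgue integral of the density is carried over to the gauge integral, the form in
  which the Taylor estimate is stated.\<close>

lemma (in prob_space) std_normal_prob_abs_le_1:
  assumes Z: "distributed M lborel Z std_normal_density"
  shows "\<P>(\<omega> in M. \<bar>Z \<omega>\<bar> \<le> 1) = integral {-1..1} (\<lambda>x. exp (- x\<^sup>2 / 2)) / sqrt (2 * pi)"
proof -
  have I: "(std_normal_density has_integral integral {-1..1} std_normal_density) {-1..1}"
    by (intro integrable_integral integrable_continuous_real)
       (auto simp: std_normal_density_def intro!: continuous_intros)
  have "{\<omega> \<in> space M. \<bar>Z \<omega>\<bar> \<le> 1} = Z -` {-1..1} \<inter> space M"
    by (auto simp: abs_le_iff)
  then have "emeasure M {\<omega> \<in> space M. \<bar>Z \<omega>\<bar> \<le> 1}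
      = (\<integral>\<^sup>+x. ennreal (std_normal_density x) * indicator {-1..1} x \<partial>lborel)"
    using distributed_emeasure[OF Z, of "{-1..1}"] by simp
  also have "\<dots> = ennreal (integral {-1..1} std_normal_density)"
    using nn_integral_has_integral_lebesgue'[OF _ I] by simp
  finally have "prob {\<omega> \<in> space M. \<bar>Z \<omega>\<bar> \<le> 1} = integral {-1..1} std_normal_density"
    using integral_nonneg[of std_normal_density "{-1..1}"] I
    by (simp add: measure_def has_integral_integrable)
  also have "\<dots> = integral {-1..1} (\<lambda>x. exp (- x\<^sup>2 / 2) / sqrt (2 * pi))"
    by (rule integral_cong) (simp add: std_normal_density_def)
  finally show ?thesis by simp
qed

lemma std_normal_one_sd_bounds:
  defines "p \<equiv> integral {-1..1} (\<lambda>x::real. exp (- x\<^sup>2 / 2)) / sqrt (2 * pi)"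
  shows "68265 / 10 ^ 5 < p" "p < 68275 / 10 ^ 5"
proof -
  \<comment> \<open>Squaring reduces these bounds to those for pi. They are tight enough to place
    the quotient within half a unit of the fourth decimal of 0.6827.\<close>
  have "sqrt (2 * pi) < 250668 / 10 ^ 5" "250658 / 10 ^ 5 < sqrt (2 * pi)"
    by (rule real_less_rsqrt real_less_lsqrt; use pi_bounds in \<open>simp add: power2_eq_square\<close>)+
  then show "68265 / 10 ^ 5 < p" "p < 68275 / 10 ^ 5"
    using integral_exp_neg_half_square_approx unfolding p_def abs_le_iff by (simp_all add: field_simps)
qed

section \<open>Rounding and the final comparison\<close>

lemma round_decimals_eqI:
  assumes "\<bar>10 ^ d * x - of_int k\<bar> < 1 / 2"
  shows "round_decimals d x = of_int k / 10 ^ d"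
  using round_unique'[of "10 ^ d * x" k] assms by (simp add: round_decimals_def)

theorem theorem2p1:
  fixes M :: "'a measure" and N :: "'b measure"
    and X :: "'a \<Rightarrow> real" and Z :: "'b \<Rightarrow> real"
    and \<mu> b :: real
  assumes "prob_space M" and "prob_space N"
    and "b > 0"
    and "laplace_random_variable M \<mu> b X"
    and "distributed N lborel Z std_normal_density"
  shows "round_decimals 7 \<P>(\<omega> in M. \<bar>X \<omega> - prob_space.expectation M X\<bar> \<le> sqrt (prob_space.variance M X)) = 0.7568833
       \<and> 0.7568833 > \<P>(\<omega> in N. \<bar>Z \<omega>\<bar> \<le> 1)
       \<and> \<P>(\<omega> in M. \<bar>X \<omega> - prob_space.expectation M X\<bar> \<le> sqrt (prob_space.variance M X)) > \<P>(\<omega> in N. \<bar>Z \<omega>\<bar> \<le> 1)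
       \<and> round_decimals 4 \<P>(\<omega> in N. \<bar>Z \<omega>\<bar> \<le> 1) = 0.6827"
proof -
  interpret M: prob_space M by fact
  interpret N: prob_space N by fact
  let ?p = "\<P>(\<omega> in M. \<bar>X \<omega> - M.expectation X\<bar> \<le> sqrt (M.variance X))"
  let ?q = "\<P>(\<omega> in N. \<bar>Z \<omega>\<bar> \<le> 1)"
  \<comment> \<open>These bounds and those for \<open>?q\<close> are the rounding intervals of
    0.7568833 and 0.6827. The two intervals are disjoint, so they also give the comparison of the
    probabilities.\<close>
  have p: "75688325 / 10 ^ 8 < ?p" "?p < 75688335 / 10 ^ 8"
    unfolding M.laplace_prob_one_sd[OF assms(3,4)] using exp_minus_sqrt_2_bounds by simp_all
  have q: "68265 / 10 ^ 5 < ?q" "?q < 68275 / 10 ^ 5"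
    unfolding N.std_normal_prob_abs_le_1[OF assms(5)] by (fact std_normal_one_sd_bounds)+
  have "\<bar>10 ^ 7 * ?p - of_int 7568833\<bar> < 1 / 2" "\<bar>10 ^ 4 * ?q - of_int 6827\<bar> < 1 / 2"
    unfolding abs_less_iff using p q by simp_all
  from this[THEN round_decimals_eqI] show ?thesis
    using p q by simp
qed

end
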